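(* Let $G=(V,E)$ be a finite simple bipartite graph, and let $\Psi(G)$ be the family of all local maximum stable sets of $G$. Then $(V,\Psi(G))$ is a greedoid if and only if every maximum matching of $G$ is uniquely restricted.
   Context: For $A\subseteq V$, $N(A)=\{v\in V-A: v \text{ has a neighbor in } A\}$ and $N[A]=A\cup N(A)$; $G[X]$ is the subgraph induced by $X$. A stable set is a set of pairwise non-adjacent vertices; a maximum stable set is a stable set of maximum cardinality. A set $A\subseteq V$ is a local maximum stable set of $G$ if $A$ is a maximum stable set of $G[N[A]]$; $\Psi(G)$ denotes the family of all such sets. A matching $M$ is uniquely restricted if $M$ is the unique perfect matching of the subgraph induced by the set of vertices saturated by $M$. A greedoid is a pair $(E,\mathcal F)$ with $\mathcal F\subseteq 2^E$ such that (Accessibility) every non-empty $X\in\mathcal F$ contains some $x$ with $X-\{x\}\in\mathcal F$, and (Exchange) for $X,Y\in\mathcal F$ with $|X|=|Y|+1$ there is $x\in X-Y$ with $Y\cup\{x\}\in\mathcal F$. *)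

theory Defs
  imports Main
begin

text \<open>
  Undirected graphs: an edge is the two-element set of its ends, so a matching is
  literally a set of edges and each edge counts once in its cardinality.
\<close>

record 'a ugraph =
  verts :: "'a set"
  edges :: "'a set set"

definition finite_simple_graph :: "'a ugraph \<Rightarrow> bool" where
  "finite_simple_graph G \<longleftrightarrow>
     finite (verts G) \<and> (\<forall>e\<in>edges G. e \<subseteq> verts G \<and> card e = 2)"

definition adjacent :: "'a ugraph \<Rightarrow> 'a \<Rightarrow> 'a \<Rightarrow> bool" where
  "adjacent G u v \<longleftrightarrow> {u, v} \<in> edges G"

definition bipartite :: "'a ugraph \<Rightarrow> bool" where
  "bipartite G \<longleftrightarrow>
     (\<exists>A B. A \<union> B = verts G \<and> A \<inter> B = {} \<and>
            (\<forall>e\<in>edges G. \<exists>a\<in>A. \<exists>b\<in>B. e = {a, b}))"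

definition induced :: "'a ugraph \<Rightarrow> 'a set \<Rightarrow> 'a ugraph" where
  "induced G X = \<lparr>verts = X \<inter> verts G, edges = {e \<in> edges G. e \<subseteq> X}\<rparr>"

definition nbhd :: "'a ugraph \<Rightarrow> 'a set \<Rightarrow> 'a set" where
  "nbhd G A = {v \<in> verts G - A. \<exists>a\<in>A. adjacent G v a}"

definition closed_nbhd :: "'a ugraph \<Rightarrow> 'a set \<Rightarrow> 'a set" where
  "closed_nbhd G A = A \<union> nbhd G A"

definition stable_set :: "'a ugraph \<Rightarrow> 'a set \<Rightarrow> bool" where
  "stable_set G S \<longleftrightarrow> S \<subseteq> verts G \<and> (\<forall>u\<in>S. \<forall>v\<in>S. \<not> adjacent G u v)"

definition maximum_stable_set :: "'a ugraph \<Rightarrow> 'a set \<Rightarrow> bool" where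
  "maximum_stable_set G S \<longleftrightarrow>
     stable_set G S \<and> (\<forall>T. stable_set G T \<longrightarrow> card T \<le> card S)"

definition Psi :: "'a ugraph \<Rightarrow> 'a set set" where
  "Psi G = {A. A \<subseteq> verts G \<and> maximum_stable_set (induced G (closed_nbhd G A)) A}"

definition matching :: "'a ugraph \<Rightarrow> 'a set set \<Rightarrow> bool" where
  "matching G M \<longleftrightarrow>
     M \<subseteq> edges G \<and> (\<forall>e\<in>M. \<forall>f\<in>M. e \<noteq> f \<longrightarrow> e \<inter> f = {})"

definition maximum_matching :: "'a ugraph \<Rightarrow> 'a set set \<Rightarrow> bool" where
  "maximum_matching G M \<longleftrightarrow>
     matching G M \<and> (\<forall>M'. matching G M' \<longrightarrow> card M' \<le> card M)"

text \<open>The vertices saturated by a set of edges \<open>M\<close> are the elements of \<open>\<Union>M\<close>.\<close>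

definition perfect_matching :: "'a ugraph \<Rightarrow> 'a set set \<Rightarrow> bool" where
  "perfect_matching G M \<longleftrightarrow> matching G M \<and> \<Union>M = verts G"

definition uniquely_restricted :: "'a ugraph \<Rightarrow> 'a set set \<Rightarrow> bool" where
  "uniquely_restricted G M \<longleftrightarrow>
     matching G M \<and>
     perfect_matching (induced G (\<Union>M)) M \<and>
     (\<forall>M'. perfect_matching (induced G (\<Union>M)) M' \<longrightarrow> M' = M)"

text \<open>
  Greedoids are finite set systems; finiteness of the ground set is part of the
  definition because \<^const>\<open>card\<close> is 0 on infinite sets.
\<close>

definition greedoid :: "'a set \<Rightarrow> 'a set set \<Rightarrow> bool" where
  "greedoid E F \<longleftrightarrow>
     finite E \<and> F \<subseteq> Pow E \<and>
     (\<forall>X\<in>F. X \<noteq> {} \<longrightarrow> (\<exists>x\<in>X. X - {x} \<in> F)) \<and>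
     (\<forall>X\<in>F. \<forall>Y\<in>F. card X = card Y + 1 \<longrightarrow> (\<exists>x\<in>X - Y. Y \<union> {x} \<in> F))"

end

theory Submission
  imports Defs
begin

text \<open>
  By Hall's theorem a stable set \<open>S\<close> of a bipartite graph lies in \<open>\<Psi>(G)\<close> iff \<open>N(S)\<close> can be
  matched into \<open>S\<close>. Such a matching extends to a maximum matching of \<open>G\<close>; if no vertex could
  be removed from \<open>S\<close>, an alternating cycle would give a second perfect matching of the
  saturated vertices, so uniquely restricted maximum matchings force accessibility, and
  accessibility implies the exchange property by a counting argument. Conversely, for a maximum
  stable set \<open>W\<close> every maximum matching matches \<open>V - W\<close> into \<open>W\<close>. The saturated part of \<open>W\<close> is in
  \<open>\<Psi>(G)\<close>, and on members \<open>X\<close> of \<open>\<Psi>(G)\<close> inside it \<open>N(X)\<close> is exactly the set of mates of \<open>X\<close>.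
  Removing vertices from \<open>X\<close> one at a time thus determines every mate.
\<close>

section \<open>Hall's marriage theorem\<close>

text \<open>Induction on the number of sets. If a non-empty proper subfamily \<open>K\<close> is
  tight, \<open>K\<close> is matched inside its union and the rest outside it; otherwise every
  non-empty proper subfamily has a surplus, so one set may take any of its elements.\<close>

theorem hall:
  fixes A :: "'i \<Rightarrow> 'b set"
  assumes "finite I" and "\<And>i. i \<in> I \<Longrightarrow> finite (A i)"
    and "\<And>J. J \<subseteq> I \<Longrightarrow> card J \<le> card (\<Union>(A ` J))"
  shows "\<exists>f. inj_on f I \<and> (\<forall>i\<in>I. f i \<in> A i)"
  using assms
proof (induction "card I" arbitrary: I A rule: less_induct)
  case less
  show ?case
  proof (cases "\<exists>K. K \<noteq> {} \<and> K \<subset> I \<and> card (\<Union>(A ` K)) = card K")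
    case True
    then obtain K where K: "K \<noteq> {}" "K \<subset> I" "card (\<Union>(A ` K)) = card K"
      by blast
    have finK: "finite K" and finD: "finite (I - K)"
      using K(2) less.prems(1) finite_subset by auto
    have cK: "card K < card I"
      using K(2) less.prems(1) by (rule psubset_card_mono[rotated])
    have "\<exists>f. inj_on f K \<and> (\<forall>i\<in>K. f i \<in> A i)"
    proof (rule less.hyps[OF cK finK])
      show "finite (A i)" if "i \<in> K" for i using less.prems(2) that K(2) by auto
      show "card J \<le> card (\<Union>(A ` J))" if "J \<subseteq> K" for J
        using less.prems(3)[of J] that K(2) by auto
    qed
    then obtain f where f: "inj_on f K" "\<And>i. i \<in> K \<Longrightarrow> f i \<in> A i" by blast
    let ?U = "\<Union>(A ` K)"
    have finU: "finite ?U" using finK less.prems(2) K(2) by auto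
    have cD: "card (I - K) < card I"
      using K(1,2) less.prems(1) by (intro psubset_card_mono) auto
    have "\<exists>g. inj_on g (I - K) \<and> (\<forall>i\<in>I - K. g i \<in> A i - ?U)"
    proof (rule less.hyps[OF cD finD])
      show "finite (A i - ?U)" if "i \<in> I - K" for i using less.prems(2) that by auto
      fix J assume J: "J \<subseteq> I - K"
      have finJ: "finite J" using J finD finite_subset by blast
      have fin: "finite (\<Union>i\<in>J. A i - ?U)" using finJ J less.prems(2) by auto
      \<comment> \<open>Hall's condition for \<open>J \<union> K\<close>, with the tight
        \<open>K\<close> cancelled, becomes Hall's condition for \<open>J\<close> after deleting
        \<open>?U\<close>.\<close>
      have "card J + card K = card (J \<union> K)"
        using J finJ finK by (subst card_Un_disjoint) auto
      also have "\<dots> \<le> card (\<Union>(A ` (J \<union> K)))"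
        using less.prems(3)[of "J \<union> K"] J K(2) by auto
      also have "\<Union>(A ` (J \<union> K)) = (\<Union>i\<in>J. A i - ?U) \<union> ?U" by auto
      also have "card \<dots> = card (\<Union>i\<in>J. A i - ?U) + card ?U"
        using fin finU by (subst card_Un_disjoint) auto
      finally show "card J \<le> card (\<Union>i\<in>J. A i - ?U)" using K(3) by simp
    qed
    then obtain g where g: "inj_on g (I - K)" "\<And>i. i \<in> I - K \<Longrightarrow> g i \<in> A i - ?U"
      by blast
    let ?h = "\<lambda>i. if i \<in> K then f i else g i"
    have "inj_on ?h I"
    proof (rule inj_onI)
      fix i j assume ij: "i \<in> I" "j \<in> I" "?h i = ?h j"
      consider "i \<in> K" "j \<in> K" | "i \<notin> K" "j \<notin> K" | "i \<in> K" "j \<notin> K" | "i \<notin> K" "j \<in> K"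
        by blast
      then show "i = j"
      proof cases
        case 1 then show ?thesis using ij f(1) by (auto dest: inj_onD)
      next
        case 2 then show ?thesis using ij g(1) by (auto dest: inj_onD)
      next
        case 3 then show ?thesis using ij f(2)[of i] g(2)[of j] by auto
      next
        case 4 then show ?thesis using ij f(2)[of j] g(2)[of i] by auto
      qed
    qed
    moreover have "\<forall>i\<in>I. ?h i \<in> A i" using f(2) g(2) by auto
    ultimately show ?thesis by (intro exI[of _ ?h]) simp
  next
    case False
    then have strict: "card K \<noteq> card (\<Union>(A ` K))" if "K \<noteq> {}" "K \<subset> I" for K
      using that by metis
    show ?thesis
    proof (cases "I = {}")
      case True
      then show ?thesis by auto
    next
      case ne: False
      then obtain i where i: "i \<in> I" by blast
      have "A i \<noteq> {}" using less.prems(3)[of "{i}"] i by auto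
      then obtain a where a: "a \<in> A i" by blast
      have c: "card (I - {i}) < card I"
        using i less.prems(1) by (rule card_Diff1_less[rotated])
      have "\<exists>g. inj_on g (I - {i}) \<and> (\<forall>j\<in>I - {i}. g j \<in> A j - {a})"
      proof (rule less.hyps[OF c])
        show "finite (I - {i})" using less.prems(1) by simp
        show "finite (A j - {a})" if "j \<in> I - {i}" for j using less.prems(2) that by auto
        fix J assume J: "J \<subseteq> I - {i}"
        have finJ: "finite J" using J less.prems(1) finite_subset by blast
        show "card J \<le> card (\<Union>j\<in>J. A j - {a})"
        proof (cases "J = {}")
          case False
          \<comment> \<open>\<open>J\<close> omits \<open>i\<close>, hence is proper; its surplus of
            one pays for the loss of \<open>a\<close>.\<close>
          have "card J \<noteq> card (\<Union>(A ` J))" using strict[of J] J False i by blast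
          moreover have "card J \<le> card (\<Union>(A ` J))"
            using less.prems(3) J by (meson Diff_subset subset_trans)
          ultimately have lt: "card J < card (\<Union>(A ` J))" by simp
          have "(\<Union>j\<in>J. A j - {a}) = \<Union>(A ` J) - {a}" by auto
          moreover have "card (\<Union>(A ` J)) - 1 \<le> card (\<Union>(A ` J) - {a})"
            by (simp add: card_Diff_singleton_if)
          ultimately show ?thesis using lt by simp
        qed simp
      qed
      then obtain g where g: "inj_on g (I - {i})" "\<And>j. j \<in> I - {i} \<Longrightarrow> g j \<in> A j - {a}"
        by blast
      have "inj_on (g(i := a)) I"
      proof (rule inj_onI)
        fix j k assume "j \<in> I" "k \<in> I" "(g(i := a)) j = (g(i := a)) k"
        then show "j = k"
          using inj_onD[OF g(1), of j k] g(2)[of j] g(2)[of k] by (auto split: if_splits)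
      qed
      moreover have "\<forall>j\<in>I. (g(i := a)) j \<in> A j" using g(2) a by auto
      ultimately show ?thesis by blast
    qed
  qed
qed

section \<open>Neighbourhoods and stable sets\<close>

lemma adjacent_sym: "adjacent G u v \<longleftrightarrow> adjacent G v u"
  by (simp add: adjacent_def insert_commute)

lemma adjacent_irrefl: "finite_simple_graph G \<Longrightarrow> \<not> adjacent G v v"
  by (auto simp: finite_simple_graph_def adjacent_def)

lemma adjacent_verts:
  "finite_simple_graph G \<Longrightarrow> adjacent G u v \<Longrightarrow> u \<in> verts G \<and> v \<in> verts G"
  by (auto simp: finite_simple_graph_def adjacent_def)

lemma edge_cases:
  assumes "finite_simple_graph G" "e \<in> edges G"
  obtains u v where "e = {u, v}" "u \<noteq> v" "u \<in> verts G" "v \<in> verts G" "adjacent G u v"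
proof -
  have "e \<subseteq> verts G" "card e = 2" using assms by (auto simp: finite_simple_graph_def)
  then obtain u v where "e = {u, v}" "u \<noteq> v" by (auto simp: card_2_iff)
  then show thesis using that assms(2) \<open>e \<subseteq> verts G\<close> by (auto simp: adjacent_def)
qed

lemma nbhd_disjoint: "nbhd G S \<inter> S = {}"
  by (auto simp: nbhd_def)

lemma nbhd_subset: "nbhd G S \<subseteq> verts G"
  by (auto simp: nbhd_def)

text \<open>A neighbour of a stable set is never inside it, so adjacency alone decides membership.
  This makes neighbourhoods of stable sets monotone.\<close>

lemma stable_set_nbhd_iff:
  "finite_simple_graph G \<Longrightarrow> stable_set G S \<Longrightarrow> y \<in> nbhd G S \<longleftrightarrow> (\<exists>a\<in>S. adjacent G y a)"
  by (auto simp: nbhd_def stable_set_def dest: adjacent_verts)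

lemma stable_set_induced:
  "stable_set (induced G X) T \<longleftrightarrow> stable_set G T \<and> T \<subseteq> X"
  by (auto simp: stable_set_def induced_def adjacent_def)

lemma stable_set_subset: "stable_set G S \<Longrightarrow> T \<subseteq> S \<Longrightarrow> stable_set G T"
  by (auto simp: stable_set_def)

text \<open>Removes the induced subgraph: its stable sets are the stable sets of \<open>G\<close>
  inside the closed neighbourhood.\<close>

lemma Psi_iff_card:
  "S \<in> Psi G \<longleftrightarrow>
     stable_set G S \<and> (\<forall>T. stable_set G T \<longrightarrow> T \<subseteq> S \<union> nbhd G S \<longrightarrow> card T \<le> card S)"
proof -
  have "stable_set G S \<Longrightarrow> S \<subseteq> verts G" by (simp add: stable_set_def)
  then show ?thesis
    unfolding Psi_def maximum_stable_set_def stable_set_induced closed_nbhd_def by blast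
qed

lemma ex_maximum_stable_set:
  assumes "finite_simple_graph G"
  shows "\<exists>W. maximum_stable_set G W"
proof -
  have "finite (verts G)" using assms by (simp add: finite_simple_graph_def)
  have "card T \<le> card (verts G)" if "stable_set G T" for T
    using \<open>finite (verts G)\<close> by (rule card_mono) (use that in \<open>simp add: stable_set_def\<close>)
  moreover have "stable_set G {}" by (simp add: stable_set_def)
  ultimately show ?thesis
    unfolding maximum_stable_set_def
    by (intro ex_has_greatest_nat[of _ "{}" _ "Suc (card (verts G))"]) (auto simp: less_Suc_eq_le)
qed

section \<open>Local maximum stable sets and matchings\<close>

text \<open>A matching of \<open>Y\<close> into \<open>S\<close> is kept as an injection, because
  Hall's theorem delivers one and the alternating arguments compose such maps.\<close>

definition mates :: "'a ugraph \<Rightarrow> ('a \<Rightarrow> 'a) \<Rightarrow> 'a set \<Rightarrow> 'a set \<Rightarrow> bool" where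
  "mates G f Y S \<longleftrightarrow> inj_on f Y \<and> (\<forall>y\<in>Y. f y \<in> S \<and> adjacent G y (f y))"

definition mate_edges :: "('a \<Rightarrow> 'a) \<Rightarrow> 'a set \<Rightarrow> 'a set set" where
  "mate_edges f Y = (\<lambda>y. {y, f y}) ` Y"

text \<open>Exchange argument: \<open>f\<close> sends \<open>T - S\<close> injectively into
  \<open>S - T\<close>, since no vertex of the stable set \<open>T\<close> has its mate in
  \<open>T\<close>.\<close>

lemma PsiI:
  assumes fs: "finite_simple_graph G" and st: "stable_set G S" and f: "mates G f (nbhd G S) S"
  shows "S \<in> Psi G"
  unfolding Psi_iff_card
proof (intro conjI allI impI st)
  fix T assume T: "stable_set G T" "T \<subseteq> S \<union> nbhd G S"
  have finS: "finite S" and finT: "finite T"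
    using fs st T(1) by (auto simp: finite_simple_graph_def stable_set_def intro: finite_subset)
  have "f ` (T - S) \<subseteq> S - T"
    using T f by (fastforce simp: mates_def stable_set_def)
  moreover have "inj_on f (T - S)"
    using T f by (auto simp: mates_def intro: inj_on_subset)
  ultimately have "card (T - S) \<le> card (S - T)"
    using finS by (metis card_image card_mono finite_Diff)
  moreover have "card T = card (T - S) + card (T \<inter> S)"
    using finT by (metis card_Int_Diff add.commute)
  moreover have "card S = card (S - T) + card (T \<inter> S)"
    using finS by (metis card_Int_Diff add.commute Int_commute)
  ultimately show "card T \<le> card S" by simp
qed

lemma bipartite_sides:
  assumes "bipartite G"
  obtains A B where "A \<union> B = verts G" "A \<inter> B = {}"
    "\<And>u v. adjacent G u v \<Longrightarrow> u \<in> A \<longleftrightarrow> v \<in> B"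
proof -
  obtain A B where AB: "A \<union> B = verts G" "A \<inter> B = {}"
      "\<forall>e\<in>edges G. \<exists>a\<in>A. \<exists>b\<in>B. e = {a, b}"
    using assms unfolding bipartite_def by (elim exE conjE) (rule that)
  have "u \<in> A \<longleftrightarrow> v \<in> B" if "adjacent G u v" for u v
  proof -
    have "{u, v} \<in> edges G" using that by (simp add: adjacent_def)
    then obtain a b where "a \<in> A" "b \<in> B" "{u, v} = {a, b}" using AB(3) by metis
    then show ?thesis using AB(2) by (auto simp: doubleton_eq_iff)
  qed
  then show thesis by (rule that[OF AB(1,2)])
qed

text \<open>Hall's condition on a subset \<open>J\<close> of \<open>N(S)\<close>: if \<open>J\<close> is stable, exchange its neighbours in
  \<open>S\<close> for \<open>J\<close>; in general, treat the two sides of the bipartition separately.\<close>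

lemma PsiE:
  assumes fs: "finite_simple_graph G" and bip: "bipartite G" and S: "S \<in> Psi G"
  obtains f where "stable_set G S" "mates G f (nbhd G S) S"
proof -
  have st: "stable_set G S"
    and mx: "\<And>T. stable_set G T \<Longrightarrow> T \<subseteq> S \<union> nbhd G S \<Longrightarrow> card T \<le> card S"
    using S by (auto simp: Psi_iff_card)
  have finV: "finite (verts G)" using fs by (simp add: finite_simple_graph_def)
  have finS: "finite S" using st finV by (auto simp: stable_set_def intro: finite_subset)
  have finN: "finite (nbhd G S)" using nbhd_subset finV by (rule finite_subset)
  define R where "R J = (\<Union>y\<in>J. {x \<in> S. adjacent G y x})" for J
  have RS: "R J \<subseteq> S" for J by (auto simp: R_def)
  have stableJ: "card J \<le> card (R J)" if J: "J \<subseteq> nbhd G S" "stable_set G J" for J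
  proof -
    have "stable_set G ((S - R J) \<union> J)"
      using st J(2) adjacent_sym[of G] by (auto simp: stable_set_def R_def)
    then have "card ((S - R J) \<union> J) \<le> card S"
      using J(1) by (intro mx) auto
    moreover have "card ((S - R J) \<union> J) = card (S - R J) + card J"
      using J(1) nbhd_disjoint[of G S] finS finite_subset[OF J(1) finN]
      by (intro card_Un_disjoint) auto
    moreover have "card (S - R J) = card S - card (R J)" "card (R J) \<le> card S"
      using RS finS by (auto intro: card_Diff_subset card_mono finite_subset)
    ultimately show ?thesis by simp
  qed
  obtain A B where AB: "A \<union> B = verts G" "A \<inter> B = {}"
      "\<And>u v. adjacent G u v \<Longrightarrow> u \<in> A \<longleftrightarrow> v \<in> B"
    using bipartite_sides[OF bip] by blast
  have "\<exists>f. inj_on f (nbhd G S) \<and> (\<forall>y\<in>nbhd G S. f y \<in> {x \<in> S. adjacent G y x})"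
  proof (rule hall[OF finN])
    show "finite {x \<in> S. adjacent G y x}" for y using finS by simp
    fix J assume J: "J \<subseteq> nbhd G S"
    have JV: "J \<subseteq> A \<union> B" using J nbhd_subset AB(1) by fast
    have finJ: "finite J" using J finN by (rule finite_subset)
    have finR: "finite (R K)" for K using RS finS by (rule finite_subset)
    have "stable_set G (J \<inter> A)" "stable_set G (J \<inter> B)"
      using AB by (auto simp: stable_set_def)
    then have "card (J \<inter> A) \<le> card (R (J \<inter> A))" "card (J \<inter> B) \<le> card (R (J \<inter> B))"
      using J by (auto intro!: stableJ)
    moreover have "card J = card (J \<inter> A) + card (J \<inter> B)"
    proof -
      have "J = (J \<inter> A) \<union> (J \<inter> B)" using JV by blast
      then show ?thesis using finJ AB(2) by (metis (no_types, lifting) card_Un_disjoint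
            finite_Int inf_assoc inf_bot_right inf_left_commute)
    qed
    \<comment> \<open>The neighbours of each side lie on the other side, so the two counts add
      up.\<close>
    moreover have "card (R (J \<inter> A)) + card (R (J \<inter> B)) = card (R (J \<inter> A) \<union> R (J \<inter> B))"
    proof -
      have "R (J \<inter> A) \<subseteq> B" "R (J \<inter> B) \<subseteq> A"
        using AB(3) adjacent_sym[of G] by (auto simp: R_def)
      then have "R (J \<inter> A) \<inter> R (J \<inter> B) = {}" using AB(2) by blast
      then show ?thesis using finR by (simp add: card_Un_disjoint)
    qed
    moreover have "card (R (J \<inter> A) \<union> R (J \<inter> B)) \<le> card (R J)"
      using finR by (intro card_mono) (auto simp: R_def)
    ultimately show "card J \<le> card (\<Union>y\<in>J. {x \<in> S. adjacent G y x})"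
      by (simp add: R_def)
  qed
  then show thesis using that st by (auto simp: mates_def)
qed

text \<open>The old \<open>f\<close> still serves if no remaining neighbour is mated to
  \<open>x\<close>. This happens when \<open>x\<close> is nobody's mate, or when the vertex mated to
  it has no other neighbour in \<open>S\<close>.\<close>

lemma Psi_removeI:
  assumes fs: "finite_simple_graph G" and st: "stable_set G S" and f: "mates G f (nbhd G S) S"
    and x: "\<And>y. y \<in> nbhd G (S - {x}) \<Longrightarrow> f y \<noteq> x"
  shows "S - {x} \<in> Psi G"
proof (rule PsiI[OF fs])
  show st': "stable_set G (S - {x})" using st by (rule stable_set_subset) auto
  have "nbhd G (S - {x}) \<subseteq> nbhd G S"
    using stable_set_nbhd_iff[OF fs st] stable_set_nbhd_iff[OF fs st'] by auto
  then show "mates G f (nbhd G (S - {x})) (S - {x})"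
    using f x by (auto simp: mates_def intro: inj_on_subset)
qed

section \<open>Matchings\<close>

lemma matching_edge_eq:
  "matching G M \<Longrightarrow> e \<in> M \<Longrightarrow> e' \<in> M \<Longrightarrow> v \<in> e \<Longrightarrow> v \<in> e' \<Longrightarrow> e = e'"
  by (auto simp: matching_def)

text \<open>Disjoint edges have distinct representatives in \<open>C\<close>: the easy half of the
  duality between matchings and vertex covers.\<close>

lemma matching_card_le:
  assumes M: "matching G M" and C: "finite C" and meet: "\<And>e. e \<in> M \<Longrightarrow> e \<inter> C \<noteq> {}"
  shows "card M \<le> card C"
proof -
  have "\<forall>e\<in>M. \<exists>c. c \<in> e \<inter> C" using meet by blast
  then obtain c where c: "\<And>e. e \<in> M \<Longrightarrow> c e \<in> e \<inter> C" by metis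
  then have "inj_on c M" using matching_edge_eq[OF M] by (intro inj_onI) (metis IntD1)
  then show ?thesis using c C by (intro card_inj_on_le[of c]) auto
qed

lemma finite_matching: "finite_simple_graph G \<Longrightarrow> matching G M \<Longrightarrow> finite M"
  unfolding finite_simple_graph_def matching_def
  by (rule finite_subset[of _ "Pow (verts G)"]) auto

lemma ex_maximum_matching:
  assumes "finite_simple_graph G"
  shows "\<exists>M. maximum_matching G M"
proof -
  have "finite (verts G)" using assms by (simp add: finite_simple_graph_def)
  have "card M \<le> card (verts G)" if M: "matching G M" for M
  proof (rule matching_card_le[OF M \<open>finite (verts G)\<close>])
    fix e assume "e \<in> M"
    then have "e \<in> edges G" using M by (auto simp: matching_def)
    then show "e \<inter> verts G \<noteq> {}" by (rule edge_cases[OF assms]) auto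
  qed
  moreover have "matching G {}" by (simp add: matching_def)
  ultimately show ?thesis
    unfolding maximum_matching_def
    by (intro ex_has_greatest_nat[of _ "{}" _ "Suc (card (verts G))"]) (auto simp: less_Suc_eq_le)
qed

lemma perfect_matching_induced:
  "perfect_matching (induced G (\<Union>M)) M' \<longleftrightarrow> matching G M' \<and> \<Union>M' = \<Union>M \<inter> verts G"
  by (auto simp: perfect_matching_def matching_def induced_def)

lemma matching_Union_subset:
  "finite_simple_graph G \<Longrightarrow> matching G M \<Longrightarrow> \<Union>M \<subseteq> verts G"
  by (auto simp: finite_simple_graph_def matching_def)

text \<open>All saturated vertices lie in \<open>G\<close>, so a perfect matching of the induced
  subgraph is just a matching of \<open>G\<close> with the same union.\<close>

lemma uniquely_restricted_iff:
  assumes "finite_simple_graph G" "matching G M"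
  shows "uniquely_restricted G M \<longleftrightarrow> (\<forall>M'. matching G M' \<longrightarrow> \<Union>M' = \<Union>M \<longrightarrow> M' = M)"
  using matching_Union_subset[OF assms] assms(2)
  by (auto simp: uniquely_restricted_def perfect_matching_induced Int_absorb2)

lemma Union_mate_edges: "\<Union>(mate_edges f Y) = Y \<union> f ` Y"
  by (auto simp: mate_edges_def)

text \<open>Disjointness of \<open>Y\<close> and \<open>S\<close> prevents \<open>{y, f y}\<close>
  and \<open>{z, f z}\<close> from coinciding with their ends swapped.\<close>

lemma card_mate_edges:
  assumes f: "mates G f Y S" and d: "Y \<inter> S = {}"
  shows "card (mate_edges f Y) = card Y"
  unfolding mate_edges_def
proof (rule card_image, rule inj_onI)
  fix y z assume "y \<in> Y" "z \<in> Y" "{y, f y} = {z, f z}"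
  then show "y = z" using f d by (auto simp: mates_def doubleton_eq_iff)
qed

lemma matching_mate_edges:
  assumes f: "mates G f Y S" and d: "Y \<inter> S = {}"
    and M: "matching G M" "\<Union>M \<inter> (Y \<union> S) = {}"
  shows "matching G (M \<union> mate_edges f Y)"
proof -
  have "mate_edges f Y \<subseteq> edges G" using f by (auto simp: mate_edges_def mates_def adjacent_def)
  moreover have new: "e \<inter> e' = {}"
    if "e \<in> mate_edges f Y" "e' \<in> mate_edges f Y" "e \<noteq> e'" for e e'
  proof -
    obtain y z where yz: "y \<in> Y" "z \<in> Y" "e = {y, f y}" "e' = {z, f z}"
      using \<open>e \<in> mate_edges f Y\<close> \<open>e' \<in> mate_edges f Y\<close> unfolding mate_edges_def by blast
    then have "y \<noteq> z" using \<open>e \<noteq> e'\<close> by blast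
    then have "f y \<noteq> f z" using f yz by (auto simp: mates_def dest: inj_onD)
    then show ?thesis using yz \<open>y \<noteq> z\<close> f d by (auto simp: mates_def)
  qed
  moreover have cross: "e \<inter> e' = {}" if "e \<in> M" "e' \<in> mate_edges f Y" for e e'
    using that M(2) f by (auto simp: mate_edges_def mates_def)
  moreover have "e \<inter> e' = {}"
    if "e \<in> M \<union> mate_edges f Y" "e' \<in> M \<union> mate_edges f Y" "e \<noteq> e'" for e e'
    using that new[of e e'] cross[of e e'] cross[of e' e] M(1)
    by (auto simp: matching_def Int_commute)
  ultimately show ?thesis using M(1) by (simp add: matching_def)
qed

text \<open>Any matching that fills the vertex cover \<open>V - W\<close> meets it exactly once per edge.\<close>

lemma matching_eq_mate_edges:
  assumes fs: "finite_simple_graph G" and st: "stable_set G W"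
    and M: "matching G M" "card (verts G - W) \<le> card M"
  obtains m where "mates G m (verts G - W) W" "M = mate_edges m (verts G - W)"
proof -
  let ?Y = "verts G - W"
  have finY: "finite ?Y" using fs by (simp add: finite_simple_graph_def)
  have "\<exists>y. y \<in> e \<inter> ?Y" if "e \<in> M" for e
  proof -
    have "e \<in> edges G" using that M(1) by (auto simp: matching_def)
    then show ?thesis using st by (elim edge_cases[OF fs]) (auto simp: stable_set_def)
  qed
  \<comment> \<open>\<open>c\<close> picks an end of each edge outside \<open>W\<close>, which
    exists because \<open>W\<close> is stable.\<close>
  then obtain c where c: "\<And>e. e \<in> M \<Longrightarrow> c e \<in> e \<inter> ?Y" by metis
  have eq: "e = e'" if "e \<in> M" "e' \<in> M" "v \<in> e" "v \<in> e'" for e e' v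
    using M(1) that by (rule matching_edge_eq)
  have "inj_on c M" using c eq by (intro inj_onI) (metis IntD1)
  then have "card (c ` M) = card M" by (rule card_image)
  moreover have "c ` M \<subseteq> ?Y" using c by blast
  ultimately have cM: "c ` M = ?Y" using M(2) finY by (intro card_seteq) auto
  \<comment> \<open>As \<open>c\<close> hits all of \<open>?Y\<close>, a second end \<open>v\<close>
    outside \<open>W\<close> would be the choice of some edge, which by disjointness is
    \<open>e\<close> itself.\<close>
  have once: "v = c e" if "e \<in> M" "v \<in> e" "v \<in> ?Y" for e v
  proof -
    obtain e' where e': "e' \<in> M" "v = c e'" using cM \<open>v \<in> ?Y\<close> by blast
    then have "e' = e" using eq[of e' e v] c[of e'] that by auto
    then show ?thesis using e' by simp
  qed
  have other: "\<exists>x. e = {c e, x} \<and> x \<in> W \<and> adjacent G (c e) x" if e: "e \<in> M" for e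
  proof -
    have "e \<in> edges G" using e M(1) by (auto simp: matching_def)
    then obtain u v where uv: "e = {u, v}" "u \<noteq> v" "u \<in> verts G" "v \<in> verts G" "adjacent G u v"
      by (rule edge_cases[OF fs])
    consider "c e = u" | "c e = v" using c[OF e] uv(1) by auto
    then show ?thesis
    proof cases
      case 1
      then show ?thesis using once[OF e, of v] uv by auto
    next
      case 2
      then show ?thesis using once[OF e, of u] uv adjacent_sym[of G] by auto
    qed
  qed
  have "\<exists>x. x \<in> W \<and> adjacent G y x \<and> {y, x} \<in> M" if "y \<in> ?Y" for y
    using cM that other by (metis imageE)
  then obtain m where m: "\<And>y. y \<in> ?Y \<Longrightarrow> m y \<in> W \<and> adjacent G y (m y) \<and> {y, m y} \<in> M"
    by metis
  have "inj_on m ?Y"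
  proof (rule inj_onI)
    fix y z assume yz: "y \<in> ?Y" "z \<in> ?Y" "m y = m z"
    then have "{y, m y} = {z, m z}"
      using m[OF yz(1)] m[OF yz(2)] eq[of "{y, m y}" "{z, m z}" "m y"] by simp
    then show "y = z"
      using yz(1,2) m[OF yz(1)] m[OF yz(2)] by (auto simp: doubleton_eq_iff)
  qed
  then have "mates G m ?Y W" using m by (simp add: mates_def)
  moreover have "M = mate_edges m ?Y"
  proof (intro subset_antisym subsetI)
    fix e assume e: "e \<in> M"
    then have "c e \<in> ?Y" "c e \<in> e" using c by auto
    then have "e = {c e, m (c e)}" using m[of "c e"] eq[of e "{c e, m (c e)}" "c e"] e by auto
    then show "e \<in> mate_edges m ?Y" using \<open>c e \<in> ?Y\<close> by (auto simp: mate_edges_def)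
  qed (use m in \<open>auto simp: mate_edges_def\<close>)
  ultimately show thesis by (rule that)
qed

text \<open>Dropping the edges that meet \<open>nbhd G S\<close> costs a maximum matching at most
  one edge per vertex of that set, and \<open>f\<close> supplies exactly as many new ones. The kept
  edges avoid \<open>S\<close> as well, since an edge at \<open>S\<close> ends in
  \<open>nbhd G S\<close>.\<close>

lemma extend_to_maximum_matching:
  assumes fs: "finite_simple_graph G" and st: "stable_set G S"
    and f: "mates G f (nbhd G S) S"
  obtains M where "matching G M" "\<Union>M \<inter> (nbhd G S \<union> S) = {}"
    "maximum_matching G (M \<union> mate_edges f (nbhd G S))"
proof -
  let ?N = "nbhd G S"
  have finN: "finite ?N"
    using fs nbhd_subset[of G S] by (auto simp: finite_simple_graph_def intro: finite_subset)
  obtain K where K: "maximum_matching G K" using ex_maximum_matching[OF fs] by blast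
  define M where "M = {e \<in> K. e \<inter> ?N = {}}"
  have mK: "matching G K" using K by (simp add: maximum_matching_def)
  then have mM: "matching G M" and mD: "matching G (K - M)"
    by (auto simp: matching_def M_def)
  have finK: "finite K" using fs mK by (rule finite_matching)
  have "e \<inter> S = {}" if e: "e \<in> M" for e
  proof -
    have "e \<in> edges G" "e \<inter> ?N = {}" using e mM by (auto simp: matching_def M_def)
    then show ?thesis
      using stable_set_nbhd_iff[OF fs st] adjacent_sym[of G]
      by (elim edge_cases[OF fs]) auto
  qed
  then have avoid: "\<Union>M \<inter> (?N \<union> S) = {}" by (auto simp: M_def)
  have "card (K - M) \<le> card ?N"
    using mD finN by (rule matching_card_le) (auto simp: M_def)
  moreover have "card K = card M + card (K - M)"
    using finK by (metis (no_types, lifting) M_def card_Diff_subset card_mono finite_subset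
        le_add_diff_inverse mem_Collect_eq subsetI)
  moreover have "card (M \<union> mate_edges f ?N) = card M + card ?N"
  proof -
    have "M \<inter> mate_edges f ?N = {}" using avoid by (auto simp: mate_edges_def)
    moreover have "finite M" "finite (mate_edges f ?N)"
      using finK finN by (auto simp: M_def mate_edges_def)
    ultimately show ?thesis
      using card_mate_edges[OF f nbhd_disjoint] by (simp add: card_Un_disjoint)
  qed
  ultimately have "card K \<le> card (M \<union> mate_edges f ?N)" by simp
  moreover have "matching G (M \<union> mate_edges f ?N)"
    using f nbhd_disjoint mM avoid by (rule matching_mate_edges)
  ultimately have "maximum_matching G (M \<union> mate_edges f ?N)"
    using K unfolding maximum_matching_def by (meson order_trans)
  then show thesis using that mM avoid by blast
qed

section \<open>Accessibility\<close>

text \<open>A smallest non-empty \<open>C\<close> closed under \<open>k\<close> works: its image is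
  closed too, hence not smaller.\<close>

lemma ex_invariant_image_eq:
  assumes "finite Y" "Y \<noteq> {}" "k ` Y \<subseteq> Y"
  obtains C where "C \<subseteq> Y" "C \<noteq> {}" "k ` C = C"
proof -
  let ?P = "\<lambda>C. C \<subseteq> Y \<and> C \<noteq> {} \<and> k ` C \<subseteq> C"
  obtain C where C: "?P C" and min: "\<And>D. ?P D \<Longrightarrow> card C \<le> card D"
    using ex_has_least_nat[of ?P Y card] assms by blast
  have "card C \<le> card (k ` C)" by (rule min) (use C in auto)
  then have "k ` C = C" using C assms(1) by (meson card_seteq finite_subset)
  then show thesis using that C by blast
qed

text \<open>If every \<open>y\<close> in \<open>N(S)\<close> had a neighbour \<open>g y\<close> in \<open>S\<close> besides its mate \<open>f y\<close>, then
  following \<open>g\<close> and \<open>f\<close> alternately would close up, and exchanging mates there would give a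
  second maximum matching on the same vertices.\<close>

lemma Psi_accessible:
  assumes fs: "finite_simple_graph G" and bip: "bipartite G"
    and ur: "\<And>M. maximum_matching G M \<Longrightarrow> uniquely_restricted G M"
    and S: "S \<in> Psi G" "S \<noteq> {}"
  shows "\<exists>x\<in>S. S - {x} \<in> Psi G"
proof -
  obtain f where st: "stable_set G S" and f: "mates G f (nbhd G S) S"
    using PsiE[OF fs bip S(1)] by blast
  let ?N = "nbhd G S"
  have finN: "finite ?N"
    using fs nbhd_subset[of G S] by (auto simp: finite_simple_graph_def intro: finite_subset)
  have inj: "inj_on f ?N" and fS: "f ` ?N \<subseteq> S" using f by (auto simp: mates_def)
  have nN: "nbhd G (S - {x}) \<subseteq> {y. \<exists>a\<in>S - {x}. adjacent G y a}" for x
    by (auto simp: nbhd_def)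
  have nN': "nbhd G (S - {x}) \<subseteq> ?N" for x
    using nN[of x] stable_set_nbhd_iff[OF fs st] by auto
  show ?thesis
  proof (rule ccontr)
    assume no: "\<not> ?thesis"
    \<comment> \<open>A vertex of \<open>S\<close> that is nobody's mate could be removed.\<close>
    have "f ` ?N = S"
    proof (rule ccontr)
      assume "f ` ?N \<noteq> S"
      then obtain x where "x \<in> S" "x \<notin> f ` ?N" using fS by blast
      moreover have "S - {x} \<in> Psi G"
        using fs st f by (rule Psi_removeI) (use calculation nN' in auto)
      ultimately show False using no by blast
    qed
    \<comment> \<open>If \<open>f y\<close> were the only neighbour of \<open>y\<close> in
      \<open>S\<close>, then \<open>y\<close> would leave the neighbourhood along with it, and
      \<open>f y\<close> could be removed.\<close>
    have "\<exists>x. x \<in> S \<and> x \<noteq> f y \<and> adjacent G y x" if y: "y \<in> ?N" for y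
    proof (rule ccontr)
      assume only: "\<not> ?thesis"
      have "S - {f y} \<in> Psi G"
        using fs st f
      proof (rule Psi_removeI)
        fix z assume z: "z \<in> nbhd G (S - {f y})"
        then have "z \<noteq> y" using nN[of "f y"] only by blast
        then show "f z \<noteq> f y" using z nN' y inj by (meson inj_onD subsetD)
      qed
      then show False using no y fS by blast
    qed
    then obtain g where g: "\<And>y. y \<in> ?N \<Longrightarrow> g y \<in> S \<and> g y \<noteq> f y \<and> adjacent G y (g y)"
      by metis
    \<comment> \<open>One step of the alternating walk: from \<open>y\<close> along \<open>g\<close>
      into \<open>S\<close>, then back to the vertex mated there by \<open>f\<close>.\<close>
    define k where "k y = inv_into ?N f (g y)" for y
    have fk: "f (k y) = g y" and kN: "k y \<in> ?N" if "y \<in> ?N" for y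
      using g[OF that] \<open>f ` ?N = S\<close>
      by (auto simp: k_def intro: f_inv_into_f inv_into_into)
    have "?N \<noteq> {}" using \<open>f ` ?N = S\<close> S(2) by auto
    then obtain C where C: "C \<subseteq> ?N" "C \<noteq> {}" "k ` C = C"
      using ex_invariant_image_eq[OF finN, of k] kN by blast
    have finC: "finite C" using C(1) finN by (rule finite_subset)
    have gC: "g ` C = f ` C"
    proof -
      have "g ` C = f ` k ` C" using fk C(1) by (force simp: image_iff)
      then show ?thesis using C(3) by simp
    qed
    have "card (g ` C) = card C"
      using gC card_image[OF inj_on_subset[OF inj C(1)]] by simp
    then have injg: "inj_on g C" using finC by (rule eq_card_imp_inj_on[rotated])
    \<comment> \<open>Swaps \<open>f\<close> for \<open>g\<close> on \<open>C\<close>; since both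
      have the same image there, the saturated vertices stay the same.\<close>
    define f' where "f' y = (if y \<in> C then g y else f y)" for y
    have f'im: "f' ` ?N = f ` ?N"
    proof -
      have "f' ` ?N = g ` C \<union> f ` (?N - C)" using C(1) by (auto simp: f'_def)
      also have "\<dots> = f ` ?N" using gC C(1) by auto
      finally show ?thesis .
    qed
    have "card (f' ` ?N) = card ?N" using f'im card_image[OF inj] by simp
    then have "inj_on f' ?N" using finN by (rule eq_card_imp_inj_on[rotated])
    then have f': "mates G f' ?N S"
      using f g C(1) by (auto simp: mates_def f'_def)
    obtain M where M: "matching G M" "\<Union>M \<inter> (?N \<union> S) = {}"
        "maximum_matching G (M \<union> mate_edges f ?N)"
      using extend_to_maximum_matching[OF fs st f] by blast
    have mf: "matching G (M \<union> mate_edges f ?N)" using M(3) by (simp add: maximum_matching_def)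
    have "matching G (M \<union> mate_edges f' ?N)"
      using f' nbhd_disjoint M(1,2) by (rule matching_mate_edges)
    moreover have "\<Union>(M \<union> mate_edges f' ?N) = \<Union>(M \<union> mate_edges f ?N)"
      by (simp add: Union_mate_edges f'im)
    ultimately have eq: "M \<union> mate_edges f' ?N = M \<union> mate_edges f ?N"
      using ur[OF M(3)] uniquely_restricted_iff[OF fs mf] by blast
    obtain y where y: "y \<in> C" using C(2) by blast
    then have yN: "y \<in> ?N" using C(1) by blast
    have "{y, g y} \<in> M \<union> mate_edges f ?N"
      unfolding eq[symmetric] using y yN by (auto simp: mate_edges_def f'_def)
    moreover have "{y, f y} \<in> M \<union> mate_edges f ?N"
      using yN by (auto simp: mate_edges_def)
    moreover have "{y, g y} \<noteq> {y, f y}" using g[OF yN] by (auto simp: doubleton_eq_iff)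
    ultimately show False using matching_edge_eq[OF mf, of "{y, g y}" "{y, f y}" y] by simp
  qed
qed

section \<open>Exchange\<close>

text \<open>With \<open>Q = X \<inter> N(Y)\<close>, the mates of \<open>Q\<close> in \<open>Y\<close> have all their mates in \<open>Q\<close> and
  exhaust it, so every neighbour of \<open>x\<close> outside \<open>N(Y)\<close> can only be mated with \<open>x\<close> itself.\<close>

lemma Psi_insert:
  assumes fs: "finite_simple_graph G" and bip: "bipartite G"
    and X: "insert x X \<in> Psi G" and Y: "Y \<in> Psi G"
    and sub: "X \<subseteq> Y \<union> nbhd G Y" and x: "x \<notin> Y \<union> nbhd G Y"
  shows "insert x Y \<in> Psi G"
proof -
  obtain f where stY: "stable_set G Y" and f: "mates G f (nbhd G Y) Y"
    using PsiE[OF fs bip Y] by blast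
  obtain h where stX: "stable_set G (insert x X)" and
      h: "mates G h (nbhd G (insert x X)) (insert x X)"
    using PsiE[OF fs bip X] by blast
  note nX = stable_set_nbhd_iff[OF fs stX] and nY = stable_set_nbhd_iff[OF fs stY]
  have finN: "finite (nbhd G Y)"
    using fs nbhd_subset[of G Y] by (auto simp: finite_simple_graph_def intro: finite_subset)
  have xV: "x \<in> verts G" using stX by (simp add: stable_set_def)
  have xY: "\<not> adjacent G x a" "\<not> adjacent G a x" if "a \<in> Y" for a
    using x that nY[of x] adjacent_sym[of G] by auto
  have st: "stable_set G (insert x Y)"
    using stY xV xY adjacent_irrefl[OF fs] by (auto simp: stable_set_def)
  define Q where "Q = X \<inter> nbhd G Y"
  have finQ: "finite Q" using finN by (simp add: Q_def)
  have "f q \<in> nbhd G (insert x X) \<and> f q \<in> Y" if "q \<in> Q" for q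
  proof -
    have "q \<in> X" "f q \<in> Y" "adjacent G (f q) q"
      using f that adjacent_sym[of G q] by (auto simp: Q_def mates_def)
    then show ?thesis by (auto simp: nX)
  qed
  then have fQ: "f ` Q \<subseteq> nbhd G (insert x X)" "f ` Q \<subseteq> Y" by auto
  \<comment> \<open>The mate under \<open>h\<close> of an \<open>a\<close> in the image of
    \<open>Q\<close> is adjacent to \<open>a \<in> Y\<close>, so it lies in \<open>nbhd G Y\<close>;
    thus it is not \<open>x\<close> and belongs to \<open>Q\<close>. Counting then gives
    equality.\<close>
  have "h ` f ` Q \<subseteq> Q"
  proof
    fix q assume "q \<in> h ` f ` Q"
    then obtain a where a: "a \<in> f ` Q" "q = h a" by blast
    then have "q \<in> insert x X" "adjacent G a q" "a \<in> Y"
      using h fQ by (auto simp: mates_def)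
    then show "q \<in> Q" using xY(2)[of a] nY[of q] adjacent_sym[of G] by (auto simp: Q_def)
  qed
  moreover have "card (h ` f ` Q) = card Q"
  proof -
    have "inj_on h (f ` Q)" using h fQ(1) by (auto simp: mates_def intro: inj_on_subset)
    moreover have "inj_on f Q" using f by (auto simp: mates_def Q_def intro: inj_on_subset)
    ultimately show ?thesis by (simp add: card_image)
  qed
  ultimately have hfQ: "h ` f ` Q = Q" using finQ by (metis card_seteq order_refl)
  \<comment> \<open>A mate other than \<open>x\<close> would lie in \<open>Q\<close>, where every
    vertex is already the mate of a vertex of \<open>Y\<close>; but \<open>z\<close> is adjacent to
    \<open>x\<close>, so it is not in \<open>Y\<close>.\<close>
  have only: "h z = x" if z: "adjacent G z x" "z \<notin> nbhd G Y" for z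
  proof (rule ccontr)
    assume ne: "h z \<noteq> x"
    have zN: "z \<in> nbhd G (insert x X)" using z by (auto simp: nX)
    then have hz: "h z \<in> X" "adjacent G z (h z)" using h ne by (auto simp: mates_def)
    have "h z \<notin> Y" using hz(2) z(2) nY by auto
    then have "h z \<in> Q" using hz sub by (auto simp: Q_def)
    then obtain a where a: "a \<in> f ` Q" "h z = h a" using hfQ by (metis imageE)
    then have "z = a" using h zN fQ(1) by (auto simp: mates_def dest: inj_onD)
    then show False using a fQ(2) z(1) xY by auto
  qed
  have single: "z = z'" if "adjacent G z x" "z \<notin> nbhd G Y" "adjacent G z' x" "z' \<notin> nbhd G Y" for z z'
  proof -
    have "h z = h z'" using only that by metis
    moreover have "z \<in> nbhd G (insert x X)" "z' \<in> nbhd G (insert x X)" using that by (auto simp: nX)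
    ultimately show ?thesis using h by (auto simp: mates_def dest: inj_onD)
  qed
  note nxY = stable_set_nbhd_iff[OF fs st]
  \<comment> \<open>New neighbours go to \<open>x\<close>; by \<open>single\<close> there is at most
    one.\<close>
  define f' where "f' y = (if y \<in> nbhd G Y then f y else x)" for y
  have f': "f' y \<in> insert x Y \<and> adjacent G y (f' y)" if "y \<in> nbhd G (insert x Y)" for y
    using that f by (auto simp: nxY nY f'_def mates_def)
  have "inj_on f' (nbhd G (insert x Y))"
  proof (rule inj_onI)
    fix y z assume yz: "y \<in> nbhd G (insert x Y)" "z \<in> nbhd G (insert x Y)" "f' y = f' z"
    have fx: "f w \<noteq> x" if "w \<in> nbhd G Y" for w using f that x by (auto simp: mates_def)
    consider "y \<in> nbhd G Y" "z \<in> nbhd G Y" | "y \<notin> nbhd G Y" "z \<notin> nbhd G Y"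
      using yz(3) fx[of y] fx[of z] by (auto simp: f'_def split: if_splits)
    then show "y = z"
    proof cases
      case 1
      then show ?thesis using yz(3) f by (auto simp: f'_def mates_def dest: inj_onD)
    next
      case 2
      then show ?thesis using yz single[of y z] by (auto simp: nxY nY)
    qed
  qed
  then have "mates G f' (nbhd G (insert x Y)) (insert x Y)" using f' by (simp add: mates_def)
  with fs st show ?thesis by (rule PsiI)
qed

text \<open>Accessibility strips \<open>X\<close> until it fits into the closed neighbourhood of
  \<open>Y\<close>; the vertex removed last is the one to insert. Non-inclusion, unlike a condition
  on sizes, can be carried through the induction.\<close>

lemma Psi_exchange:
  assumes fs: "finite_simple_graph G" and bip: "bipartite G"
    and acc: "\<And>S. S \<in> Psi G \<Longrightarrow> S \<noteq> {} \<Longrightarrow> \<exists>x\<in>S. S - {x} \<in> Psi G"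
    and Y: "Y \<in> Psi G" and X: "X \<in> Psi G" "\<not> X \<subseteq> Y \<union> nbhd G Y"
  shows "\<exists>x\<in>X - Y. insert x Y \<in> Psi G"
  using X
proof (induction "card X" arbitrary: X rule: less_induct)
  case less
  have finX: "finite X"
    using less.prems(1) fs
    by (auto simp: Psi_def finite_simple_graph_def intro: finite_subset)
  obtain x where x: "x \<in> X" "X - {x} \<in> Psi G" using acc less.prems by blast
  show ?case
  proof (cases "X - {x} \<subseteq> Y \<union> nbhd G Y")
    case True
    moreover have "x \<notin> Y \<union> nbhd G Y" using True less.prems(2) by blast
    moreover have "insert x (X - {x}) \<in> Psi G" using x less.prems(1) by (simp add: insert_absorb)
    ultimately have "insert x Y \<in> Psi G" using Psi_insert[OF fs bip _ Y] by blast
    then show ?thesis using x(1) \<open>x \<notin> Y \<union> nbhd G Y\<close> by blast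
  next
    case False
    have "card (X - {x}) < card X" using finX x(1) by (rule card_Diff1_less)
    then show ?thesis using less.hyps x(2) False by blast
  qed
qed

section \<open>Uniqueness of maximum matchings\<close>

text \<open>Subsets of \<open>m ` (V - W)\<close> have at least as many neighbours as elements, members of \<open>Psi\<close>
  at most as many.\<close>

lemma nbhd_eq_mates_preimage:
  assumes fs: "finite_simple_graph G" and bip: "bipartite G"
    and W: "stable_set G W" and m: "mates G m (verts G - W) W"
    and X: "X \<in> Psi G" "X \<subseteq> m ` (verts G - W)"
  shows "nbhd G X = {y \<in> verts G - W. m y \<in> X}"
proof -
  let ?P = "{y \<in> verts G - W. m y \<in> X}"
  obtain h where h: "mates G h (nbhd G X) X" using PsiE[OF fs bip X(1)] by blast
  have finV: "finite (verts G)" using fs by (simp add: finite_simple_graph_def)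
  have finN: "finite (nbhd G X)" using nbhd_subset finV by (rule finite_subset)
  have finX: "finite X" using X(2) finV by (meson finite_Diff finite_imageI finite_subset)
  have "X \<subseteq> W" using X(2) m by (auto simp: mates_def)
  then have sub: "?P \<subseteq> nbhd G X" using m by (auto simp: nbhd_def mates_def)
  have "card (nbhd G X) \<le> card X"
    using h finX by (intro card_inj_on_le[of h]) (auto simp: mates_def)
  moreover have "card (m ` ?P) \<le> card ?P" using finV by (intro card_image_le) simp
  moreover have "m ` ?P = X" using X(2) by auto
  ultimately show ?thesis using card_seteq[OF finN sub] by simp
qed

text \<open>The preimages of a member of \<open>Psi G\<close> under \<open>m\<close> and
  \<open>m'\<close> are both its neighbourhood. At the step that removes \<open>m y\<close>, the
  vertex \<open>m' y\<close> lies in \<open>X\<close> but not in \<open>X - {x}\<close>, so it is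
  \<open>x\<close> as well.\<close>

lemma mates_unique:
  assumes fs: "finite_simple_graph G" and bip: "bipartite G"
    and acc: "\<And>S. S \<in> Psi G \<Longrightarrow> S \<noteq> {} \<Longrightarrow> \<exists>x\<in>S. S - {x} \<in> Psi G"
    and W: "stable_set G W"
    and m: "mates G m (verts G - W) W" and m': "mates G m' (verts G - W) W"
    and im: "m ` (verts G - W) = m' ` (verts G - W)"
    and X: "X \<in> Psi G" "X \<subseteq> m ` (verts G - W)"
    and y: "y \<in> verts G - W" "m y \<in> X"
  shows "m' y = m y"
  using X y(2)
proof (induction "card X" arbitrary: X rule: less_induct)
  case less
  have finX: "finite X"
    using less.prems(1) fs
    by (auto simp: Psi_def finite_simple_graph_def intro: finite_subset)
  obtain x where x: "x \<in> X" "X - {x} \<in> Psi G" using acc less.prems by blast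
  have sub: "X - {x} \<subseteq> m ` (verts G - W)" using less.prems(2) by blast
  show ?case
  proof (cases "m y = x")
    case True
    have pre: "m z \<in> Z \<longleftrightarrow> m' z \<in> Z" if "z \<in> verts G - W" "Z \<in> Psi G" "Z \<subseteq> m ` (verts G - W)" for z Z
      using nbhd_eq_mates_preimage[OF fs bip W m, of Z] nbhd_eq_mates_preimage[OF fs bip W m', of Z]
        that im by blast
    have "m' y \<in> X" using pre[OF y(1) less.prems(1,2)] less.prems(3) by simp
    moreover have "m' y \<notin> X - {x}" using pre[OF y(1) x(2) sub] True by simp
    ultimately show ?thesis using True by simp
  next
    case False
    have "card (X - {x}) < card X" using finX x(1) by (rule card_Diff1_less)
    then show ?thesis using less.hyps x(2) sub less.prems(3) False by blast
  qed
qed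

lemma uniquely_restricted_if_accessible:
  assumes fs: "finite_simple_graph G" and bip: "bipartite G"
    and acc: "\<And>S. S \<in> Psi G \<Longrightarrow> S \<noteq> {} \<Longrightarrow> \<exists>x\<in>S. S - {x} \<in> Psi G"
    and M: "maximum_matching G M"
  shows "uniquely_restricted G M"
proof -
  have mM: "matching G M" using M by (simp add: maximum_matching_def)
  have finV: "finite (verts G)" using fs by (simp add: finite_simple_graph_def)
  obtain W where W: "maximum_stable_set G W" using ex_maximum_stable_set[OF fs] by blast
  then have st: "stable_set G W" by (simp add: maximum_stable_set_def)
  let ?Y = "verts G - W"
  have "W \<in> Psi G" using W by (auto simp: Psi_iff_card maximum_stable_set_def)
  then obtain f where f: "mates G f (nbhd G W) W" using PsiE[OF fs bip] by blast
  \<comment> \<open>A vertex outside \<open>W\<close> with no neighbour in \<open>W\<close> could be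
    added to \<open>W\<close>.\<close>
  have nW: "nbhd G W = ?Y"
  proof (rule ccontr)
    assume "nbhd G W \<noteq> ?Y"
    then obtain v where v: "v \<in> ?Y" "v \<notin> nbhd G W" by (auto simp: nbhd_def)
    have "\<not> adjacent G v a" "\<not> adjacent G a v" if "a \<in> W" for a
      using v(2) that stable_set_nbhd_iff[OF fs st, of v] adjacent_sym[of G] by auto
    then have "stable_set G (insert v W)"
      using st v(1) adjacent_irrefl[OF fs] by (auto simp: stable_set_def)
    then have "card (insert v W) \<le> card W" using W by (simp add: maximum_stable_set_def)
    moreover have "finite W" using st finV by (auto simp: stable_set_def intro: finite_subset)
    ultimately show False using v(1) by simp
  qed
  have "matching G ({} \<union> mate_edges f ?Y)"
    using f by (intro matching_mate_edges[of _ _ _ W]) (auto simp: nW matching_def)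
  then have "card (mate_edges f ?Y) \<le> card M" using M by (simp add: maximum_matching_def)
  moreover have "card (mate_edges f ?Y) = card ?Y"
    using f nW by (intro card_mate_edges[of G _ _ W]) auto
  ultimately have cM: "card ?Y \<le> card M" by simp
  obtain m where m: "mates G m ?Y W" "M = mate_edges m ?Y"
    using matching_eq_mate_edges[OF fs st mM cM] by blast
  \<comment> \<open>Counting ends shows that matchings with the same saturated vertices have equally
    many edges, so \<open>M'\<close> inherits the size bound of \<open>M\<close>.\<close>
  have card2: "2 * card K = card (\<Union>K)" if "matching G K" for K
  proof (rule card_partition)
    show "finite K" using fs that by (rule finite_matching)
    show "finite (\<Union>K)" using matching_Union_subset[OF fs that] finV by (rule finite_subset)
  qed (use that fs in \<open>auto simp: matching_def finite_simple_graph_def\<close>)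
  show ?thesis
    unfolding uniquely_restricted_iff[OF fs mM]
  proof (intro allI impI)
    fix M' assume M': "matching G M'" "\<Union>M' = \<Union>M"
    have "card ?Y \<le> card M'" using card2[OF mM] card2[OF M'(1)] M'(2) cM by simp
    then obtain m' where m': "mates G m' ?Y W" "M' = mate_edges m' ?Y"
      using matching_eq_mate_edges[OF fs st M'(1)] by blast
    have "\<Union>M \<inter> W = m ` ?Y" using m by (auto simp: Union_mate_edges mates_def)
    moreover have "\<Union>M' \<inter> W = m' ` ?Y" using m' by (auto simp: Union_mate_edges mates_def)
    ultimately have im: "m ` ?Y = m' ` ?Y" using M'(2) by simp
    let ?X = "m ` ?Y"
    have XW: "?X \<subseteq> W" using m(1) by (auto simp: mates_def)
    have stX: "stable_set G ?X" using st XW by (rule stable_set_subset)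
    have "nbhd G ?X \<subseteq> ?Y"
    proof
      fix y assume "y \<in> nbhd G ?X"
      then obtain a where "a \<in> ?X" "adjacent G y a" using stable_set_nbhd_iff[OF fs stX] by blast
      then have "y \<in> nbhd G W" using XW stable_set_nbhd_iff[OF fs st] by blast
      then show "y \<in> ?Y" by (simp only: nW)
    qed
    \<comment> \<open>\<open>m\<close> itself witnesses membership in \<open>Psi G\<close>, as every
      neighbour of \<open>?X\<close> lies in \<open>?Y\<close>.\<close>
    then have "mates G m (nbhd G ?X) ?X"
      using m(1) by (auto simp: mates_def intro: inj_on_subset)
    with fs stX have "?X \<in> Psi G" by (rule PsiI)
    then have "m' y = m y" if "y \<in> ?Y" for y
      using mates_unique[OF fs bip acc st m(1) m'(1) im _ order_refl that] that by blast
    then show "M' = M" unfolding m(2) m'(2) mate_edges_def by (intro image_cong) auto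
  qed
qed

theorem theorem4:
  fixes G :: "'a ugraph"
  assumes "finite_simple_graph G" and "bipartite G"
  shows "greedoid (verts G) (Psi G) \<longleftrightarrow>
         (\<forall>M. maximum_matching G M \<longrightarrow> uniquely_restricted G M)"
proof
  assume "greedoid (verts G) (Psi G)"
  then have "\<And>S. S \<in> Psi G \<Longrightarrow> S \<noteq> {} \<Longrightarrow> \<exists>x\<in>S. S - {x} \<in> Psi G"
    by (simp add: greedoid_def)
  then show "\<forall>M. maximum_matching G M \<longrightarrow> uniquely_restricted G M"
    using uniquely_restricted_if_accessible[OF assms] by simp
next
  assume "\<forall>M. maximum_matching G M \<longrightarrow> uniquely_restricted G M"
  then have acc: "\<And>S. S \<in> Psi G \<Longrightarrow> S \<noteq> {} \<Longrightarrow> \<exists>x\<in>S. S - {x} \<in> Psi G"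
    using Psi_accessible[OF assms] by blast
  have "\<exists>x\<in>X - Y. Y \<union> {x} \<in> Psi G"
    if X: "X \<in> Psi G" and Y: "Y \<in> Psi G" and c: "card X = card Y + 1" for X Y
  proof -
    \<comment> \<open>Otherwise \<open>X\<close> would be a stable set in the closed neighbourhood
      of \<open>Y\<close> with more elements than \<open>Y\<close>.\<close>
    have "\<not> X \<subseteq> Y \<union> nbhd G Y" using X Y c by (fastforce simp: Psi_iff_card)
    then show ?thesis using Psi_exchange[OF assms acc Y X] by simp
  qed
  then show "greedoid (verts G) (Psi G)"
    unfolding greedoid_def using acc assms(1) by (auto simp: finite_simple_graph_def Psi_def)
qed

end
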